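(* Let $I$ be a set and let $\mathcal{C}$ be an $\mathbf{AMon}$ category with a zero object in which every family of objects indexed by $I$ has a product and a coproduct. If the functors $\bigoplus_{i\in I}:\mathcal{C}^I\to\mathcal{C}$ and $\prod_{i\in I}:\mathcal{C}^I\to\mathcal{C}$ are isomorphic (by some natural isomorphism), then the canonical morphism from $\bigoplus_{i\in I}$ to $\prod_{i\in I}$ is a functorial (natural) isomorphism.
   Context: An $\mathbf{AMon}$ category is a category in which, for any objects $X,Y$, the set $\mathrm{Hom}(X,Y)$ carries the structure of an abelian monoid (written additively) compatible with composition, i.e. composition is additive in each variable and sends the neutral element to the neutral element in each variable. A zero object is an object that is both initial and terminal; $0:A\to B$ denotes the composite $A\to 0\to B$. $\mathcal{C}^I$ is the product category of $I$-indexed families of objects. For $A=(A_i)_{i\in I}\in\mathcal{C}^I$ let $\sigma_k:A_k\to\bigoplus_{i\in I}A_i$ be the canonical injections and $p_k:\prod_{i\in I}A_i\to A_k$ the canonical projections. The canonical functorial morphism $F:\bigoplus_{i\in I}\to\prod_{i\in I}$ is the one whose component $F_A:\bigoplus_{i\in I}A_i\to\prod_{i\in I}A_i$ is determined by $p_lF_A\sigma_k=0$ for $k\neq l$ and $p_kF_A\sigma_k=1_{A_k}$ for all $k\in I$. *)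

theory Defs
  imports "HOL-Algebra.Group"
begin

section \<open>Categories\<close>

(* Comp C g f is the composite "g after f", meaningful only if Dom C g = Cod C f. *)
record ('o, 'a) cat =
  Obj :: "'o set"
  Arr :: "'a set"
  Dom :: "'a \<Rightarrow> 'o"
  Cod :: "'a \<Rightarrow> 'o"
  Id :: "'o \<Rightarrow> 'a"
  Comp :: "'a \<Rightarrow> 'a \<Rightarrow> 'a" (infixr "\<cdot>\<index>" 70)

definition Hom :: "('o, 'a, 'x) cat_scheme \<Rightarrow> 'o \<Rightarrow> 'o \<Rightarrow> 'a set" where
  "Hom C X Y = {f \<in> Arr C. Dom C f = X \<and> Cod C f = Y}"

locale category =
  fixes C :: "('o, 'a, 'x) cat_scheme" (structure)
  assumes Dom_closed: "f \<in> Arr C \<Longrightarrow> Dom C f \<in> Obj C"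
    and Cod_closed: "f \<in> Arr C \<Longrightarrow> Cod C f \<in> Obj C"
    and Id_closed: "X \<in> Obj C \<Longrightarrow> Id C X \<in> Hom C X X"
    and Comp_closed: "f \<in> Hom C X Y \<Longrightarrow> g \<in> Hom C Y Z \<Longrightarrow> g \<cdot> f \<in> Hom C X Z"
    and Id_left: "f \<in> Hom C X Y \<Longrightarrow> Id C Y \<cdot> f = f"
    and Id_right: "f \<in> Hom C X Y \<Longrightarrow> f \<cdot> Id C X = f"
    and Comp_assoc: "f \<in> Hom C W X \<Longrightarrow> g \<in> Hom C X Y \<Longrightarrow> h \<in> Hom C Y Z \<Longrightarrow>
      (h \<cdot> g) \<cdot> f = h \<cdot> (g \<cdot> f)"

definition iso_arr :: "('o, 'a, 'x) cat_scheme \<Rightarrow> 'a \<Rightarrow> bool" where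
  "iso_arr C f \<longleftrightarrow> f \<in> Arr C \<and>
    (\<exists>g \<in> Hom C (Cod C f) (Dom C f).
       g \<cdot>\<^bsub>C\<^esub> f = Id C (Dom C f) \<and> f \<cdot>\<^bsub>C\<^esub> g = Id C (Cod C f))"

(* H X Y is the abelian monoid on Hom C X Y; the library writes its operation
   (the addition of arrows) as \<otimes> and its neutral element as \<one>. *)
locale amon_category = category C
  for C :: "('o, 'a, 'x) cat_scheme" (structure) +
  fixes H :: "'o \<Rightarrow> 'o \<Rightarrow> 'a monoid"
  assumes carrier_H: "X \<in> Obj C \<Longrightarrow> Y \<in> Obj C \<Longrightarrow> carrier (H X Y) = Hom C X Y"
    and comm_monoid_H: "X \<in> Obj C \<Longrightarrow> Y \<in> Obj C \<Longrightarrow> comm_monoid (H X Y)"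
    and Comp_add_left: "f \<in> Hom C X Y \<Longrightarrow> g \<in> Hom C Y Z \<Longrightarrow> g' \<in> Hom C Y Z \<Longrightarrow>
      (g \<otimes>\<^bsub>H Y Z\<^esub> g') \<cdot> f = (g \<cdot> f) \<otimes>\<^bsub>H X Z\<^esub> (g' \<cdot> f)"
    and Comp_add_right: "f \<in> Hom C X Y \<Longrightarrow> f' \<in> Hom C X Y \<Longrightarrow> g \<in> Hom C Y Z \<Longrightarrow>
      g \<cdot> (f \<otimes>\<^bsub>H X Y\<^esub> f') = (g \<cdot> f) \<otimes>\<^bsub>H X Z\<^esub> (g \<cdot> f')"
    and Comp_neutral_left: "f \<in> Hom C X Y \<Longrightarrow> Z \<in> Obj C \<Longrightarrow>
      \<one>\<^bsub>H Y Z\<^esub> \<cdot> f = \<one>\<^bsub>H X Z\<^esub>"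
    and Comp_neutral_right: "X \<in> Obj C \<Longrightarrow> g \<in> Hom C Y Z \<Longrightarrow>
      g \<cdot> \<one>\<^bsub>H X Y\<^esub> = \<one>\<^bsub>H X Z\<^esub>"

section \<open>Zero objects, products and coproducts\<close>

definition initial_object :: "('o, 'a, 'x) cat_scheme \<Rightarrow> 'o \<Rightarrow> bool" where
  "initial_object C Z \<longleftrightarrow> Z \<in> Obj C \<and> (\<forall>X \<in> Obj C. \<exists>!f. f \<in> Hom C Z X)"

definition terminal_object :: "('o, 'a, 'x) cat_scheme \<Rightarrow> 'o \<Rightarrow> bool" where
  "terminal_object C Z \<longleftrightarrow> Z \<in> Obj C \<and> (\<forall>X \<in> Obj C. \<exists>!f. f \<in> Hom C X Z)"

definition zero_object :: "('o, 'a, 'x) cat_scheme \<Rightarrow> 'o \<Rightarrow> bool" where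
  "zero_object C Z \<longleftrightarrow> initial_object C Z \<and> terminal_object C Z"

(* The composite X \<rightarrow> 0 \<rightarrow> Y; it does not depend on the choice of the zero object. *)
definition zero_arr :: "('o, 'a, 'x) cat_scheme \<Rightarrow> 'o \<Rightarrow> 'o \<Rightarrow> 'a" where
  "zero_arr C X Y =
    (THE h. \<exists>Z u v. zero_object C Z \<and> u \<in> Hom C X Z \<and> v \<in> Hom C Z Y \<and> h = v \<cdot>\<^bsub>C\<^esub> u)"

definition is_coproduct ::
  "('o, 'a, 'x) cat_scheme \<Rightarrow> 'i set \<Rightarrow> ('i \<Rightarrow> 'o) \<Rightarrow> 'o \<Rightarrow> ('i \<Rightarrow> 'a) \<Rightarrow> bool" where
  "is_coproduct C I A S \<sigma> \<longleftrightarrow>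
    S \<in> Obj C \<and> (\<forall>k \<in> I. \<sigma> k \<in> Hom C (A k) S) \<and>
    (\<forall>X \<in> Obj C. \<forall>g. (\<forall>k \<in> I. g k \<in> Hom C (A k) X) \<longrightarrow>
       (\<exists>!h. h \<in> Hom C S X \<and> (\<forall>k \<in> I. h \<cdot>\<^bsub>C\<^esub> \<sigma> k = g k)))"

definition is_product ::
  "('o, 'a, 'x) cat_scheme \<Rightarrow> 'i set \<Rightarrow> ('i \<Rightarrow> 'o) \<Rightarrow> 'o \<Rightarrow> ('i \<Rightarrow> 'a) \<Rightarrow> bool" where
  "is_product C I A P p \<longleftrightarrow>
    P \<in> Obj C \<and> (\<forall>k \<in> I. p k \<in> Hom C P (A k)) \<and>
    (\<forall>X \<in> Obj C. \<forall>g. (\<forall>k \<in> I. g k \<in> Hom C X (A k)) \<longrightarrow>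
       (\<exists>!h. h \<in> Hom C X P \<and> (\<forall>k \<in> I. p k \<cdot>\<^bsub>C\<^esub> h = g k)))"

section \<open>Functors and natural transformations\<close>

record ('o, 'a, 'p, 'b) ftor =
  FObj :: "'o \<Rightarrow> 'p"
  FArr :: "'a \<Rightarrow> 'b"

definition is_ftor ::
  "('o, 'a, 'x) cat_scheme \<Rightarrow> ('p, 'b, 'y) cat_scheme \<Rightarrow> ('o, 'a, 'p, 'b) ftor \<Rightarrow> bool" where
  "is_ftor C D F \<longleftrightarrow> category C \<and> category D \<and>
    (\<forall>X \<in> Obj C. FObj F X \<in> Obj D) \<and>
    (\<forall>X Y. \<forall>f \<in> Hom C X Y. FArr F f \<in> Hom D (FObj F X) (FObj F Y)) \<and>
    (\<forall>X \<in> Obj C. FArr F (Id C X) = Id D (FObj F X)) \<and>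
    (\<forall>X Y Z. \<forall>f \<in> Hom C X Y. \<forall>g \<in> Hom C Y Z.
       FArr F (g \<cdot>\<^bsub>C\<^esub> f) = FArr F g \<cdot>\<^bsub>D\<^esub> FArr F f)"

definition natural_transformation ::
  "('o, 'a, 'x) cat_scheme \<Rightarrow> ('p, 'b, 'y) cat_scheme \<Rightarrow>
   ('o, 'a, 'p, 'b) ftor \<Rightarrow> ('o, 'a, 'p, 'b) ftor \<Rightarrow> ('o \<Rightarrow> 'b) \<Rightarrow> bool" where
  "natural_transformation C D F G \<tau> \<longleftrightarrow> is_ftor C D F \<and> is_ftor C D G \<and>
    (\<forall>X \<in> Obj C. \<tau> X \<in> Hom D (FObj F X) (FObj G X)) \<and>
    (\<forall>X Y. \<forall>f \<in> Hom C X Y. \<tau> Y \<cdot>\<^bsub>D\<^esub> FArr F f = FArr G f \<cdot>\<^bsub>D\<^esub> \<tau> X)"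

definition natural_isomorphism ::
  "('o, 'a, 'x) cat_scheme \<Rightarrow> ('p, 'b, 'y) cat_scheme \<Rightarrow>
   ('o, 'a, 'p, 'b) ftor \<Rightarrow> ('o, 'a, 'p, 'b) ftor \<Rightarrow> ('o \<Rightarrow> 'b) \<Rightarrow> bool" where
  "natural_isomorphism C D F G \<tau> \<longleftrightarrow>
    natural_transformation C D F G \<tau> \<and> (\<forall>X \<in> Obj C. iso_arr D (\<tau> X))"

section \<open>Families of objects, and the coproduct and product functors\<close>

(* Families are extensional functions on I, so that equality of objects and of
   arrows is equality of I-indexed families. *)
definition power_cat ::
  "'i set \<Rightarrow> ('o, 'a, 'x) cat_scheme \<Rightarrow> ('i \<Rightarrow> 'o, 'i \<Rightarrow> 'a) cat" where
  "power_cat I C =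
    \<lparr> Obj = (I \<rightarrow>\<^sub>E Obj C),
      Arr = (I \<rightarrow>\<^sub>E Arr C),
      Dom = (\<lambda>f. \<lambda>i\<in>I. Dom C (f i)),
      Cod = (\<lambda>f. \<lambda>i\<in>I. Cod C (f i)),
      Id = (\<lambda>A. \<lambda>i\<in>I. Id C (A i)),
      Comp = (\<lambda>g f. \<lambda>i\<in>I. g i \<cdot>\<^bsub>C\<^esub> f i) \<rparr>"

(* The functors depend on a choice, for every family A, of a coproduct S A with
   injections \<sigma> A k, and of a product P A with projections p A k. *)
definition coproduct_choice ::
  "('o, 'a, 'x) cat_scheme \<Rightarrow> 'i set \<Rightarrow> (('i \<Rightarrow> 'o) \<Rightarrow> 'o) \<Rightarrow> (('i \<Rightarrow> 'o) \<Rightarrow> 'i \<Rightarrow> 'a) \<Rightarrow> bool"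
  where
  "coproduct_choice C I S \<sigma> \<longleftrightarrow>
    (\<forall>A \<in> Obj (power_cat I C). is_coproduct C I A (S A) (\<sigma> A))"

definition product_choice ::
  "('o, 'a, 'x) cat_scheme \<Rightarrow> 'i set \<Rightarrow> (('i \<Rightarrow> 'o) \<Rightarrow> 'o) \<Rightarrow> (('i \<Rightarrow> 'o) \<Rightarrow> 'i \<Rightarrow> 'a) \<Rightarrow> bool"
  where
  "product_choice C I P p \<longleftrightarrow>
    (\<forall>A \<in> Obj (power_cat I C). is_product C I A (P A) (p A))"

definition coproduct_ftor ::
  "('o, 'a, 'x) cat_scheme \<Rightarrow> 'i set \<Rightarrow> (('i \<Rightarrow> 'o) \<Rightarrow> 'o) \<Rightarrow> (('i \<Rightarrow> 'o) \<Rightarrow> 'i \<Rightarrow> 'a) \<Rightarrow>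
   ('i \<Rightarrow> 'o, 'i \<Rightarrow> 'a, 'o, 'a) ftor" where
  "coproduct_ftor C I S \<sigma> =
    \<lparr> FObj = S,
      FArr = (\<lambda>f. let A = Dom (power_cat I C) f; B = Cod (power_cat I C) f in
        THE h. h \<in> Hom C (S A) (S B) \<and> (\<forall>k \<in> I. h \<cdot>\<^bsub>C\<^esub> \<sigma> A k = \<sigma> B k \<cdot>\<^bsub>C\<^esub> f k)) \<rparr>"

definition product_ftor ::
  "('o, 'a, 'x) cat_scheme \<Rightarrow> 'i set \<Rightarrow> (('i \<Rightarrow> 'o) \<Rightarrow> 'o) \<Rightarrow> (('i \<Rightarrow> 'o) \<Rightarrow> 'i \<Rightarrow> 'a) \<Rightarrow>
   ('i \<Rightarrow> 'o, 'i \<Rightarrow> 'a, 'o, 'a) ftor" where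
  "product_ftor C I P p =
    \<lparr> FObj = P,
      FArr = (\<lambda>f. let A = Dom (power_cat I C) f; B = Cod (power_cat I C) f in
        THE h. h \<in> Hom C (P A) (P B) \<and> (\<forall>k \<in> I. p B k \<cdot>\<^bsub>C\<^esub> h = f k \<cdot>\<^bsub>C\<^esub> p A k)) \<rparr>"

definition canonical_morphism ::
  "('o, 'a, 'x) cat_scheme \<Rightarrow> 'i set \<Rightarrow>
   (('i \<Rightarrow> 'o) \<Rightarrow> 'o) \<Rightarrow> (('i \<Rightarrow> 'o) \<Rightarrow> 'i \<Rightarrow> 'a) \<Rightarrow>
   (('i \<Rightarrow> 'o) \<Rightarrow> 'o) \<Rightarrow> (('i \<Rightarrow> 'o) \<Rightarrow> 'i \<Rightarrow> 'a) \<Rightarrow> ('i \<Rightarrow> 'o) \<Rightarrow> 'a" where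
  "canonical_morphism C I S \<sigma> P p A =
    (THE h. h \<in> Hom C (S A) (P A) \<and>
       (\<forall>k \<in> I. \<forall>l \<in> I. p A l \<cdot>\<^bsub>C\<^esub> h \<cdot>\<^bsub>C\<^esub> \<sigma> A k =
          (if k = l then Id C (A k) else zero_arr C (A k) (A l))))"

end

theory Submission
  imports Defs
begin

text \<open>
  An arrow from a coproduct \<open>\<Oplus>A\<close> to a product \<open>\<Prod>B\<close> is the same thing as a matrix of arrows
  \<open>A k \<rightarrow> B l\<close>. Write \<open>F\<close> for the canonical morphism, whose matrix is the identity matrix. For
  every arrow \<open>f : A \<rightarrow> B\<close> of families, both \<open>F\<^sub>B \<circ> \<Oplus>f\<close> and \<open>\<Prod>f \<circ> F\<^sub>A\<close> have the
  diagonal matrix with entries \<open>f k\<close>, so any arrow with that matrix factors through \<open>F\<close>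
  in both ways (\<open>diagonal_arrow_factors\<close>). In particular \<open>F\<close> is natural.

  Now let \<open>\<phi>\<close> be any natural isomorphism from \<open>\<Oplus>\<close> to \<open>\<Prod>\<close>. Naturality with respect to the
  endomorphism of \<open>A\<close> that is the identity at one index \<open>k\<close> and zero elsewhere forces the
  matrix of \<open>\<phi>\<^sub>A\<close> to be diagonal (\<open>natural_entries_off_diagonal\<close>), with some
  endomorphisms \<open>\<theta> k\<close> of \<open>A k\<close> on the diagonal. Hence
  \<open>F\<^sub>A \<circ> \<Oplus>\<theta> = \<phi>\<^sub>A = \<Prod>\<theta> \<circ> F\<^sub>A\<close>. Since \<open>\<phi>\<^sub>A\<close> is invertible,
  the first factorisation gives \<open>F\<^sub>A\<close> a right inverse and the second a left inverse. The
  \<open>\<theta> k\<close> themselves are never shown to be invertible: it is enough that \<open>F\<^sub>A\<close> is a factor of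
  \<open>\<phi>\<^sub>A\<close> on either side.
\<close>

section \<open>Isomorphisms and matrices of arrows\<close>

context category
begin

lemma Hom_dest:
  assumes "f \<in> Hom C X Y"
  shows "X \<in> Obj C" "Y \<in> Obj C" "f \<in> Arr C" "Dom C f = X" "Cod C f = Y"
  using assms Dom_closed[of f] Cod_closed[of f] by (auto simp: Hom_def)

text \<open>
  Composing \<open>a\<close> and \<open>b\<close> with the inverse of \<open>\<phi>\<close> gives a right and a left inverse of
  \<open>f\<close>, and these agree.
\<close>
lemma iso_arr_two_sided_factor:
  assumes f: "f \<in> Hom C X Y" and a: "a \<in> Hom C X X" and b: "b \<in> Hom C Y Y"
    and fa: "f \<cdot> a = \<phi>" and bf: "b \<cdot> f = \<phi>" and iso: "iso_arr C \<phi>"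
  shows "iso_arr C f"
proof -
  have phi: "\<phi> \<in> Hom C X Y" using Comp_closed[OF a f] fa by simp
  obtain \<psi> where psi: "\<psi> \<in> Hom C Y X" and "\<psi> \<cdot> \<phi> = Id C X" "\<phi> \<cdot> \<psi> = Id C Y"
    using iso Hom_dest[OF phi] unfolding iso_arr_def by auto
  define l where "l = \<psi> \<cdot> b"
  define r where "r = a \<cdot> \<psi>"
  have l: "l \<in> Hom C Y X" and r: "r \<in> Hom C Y X"
    unfolding l_def r_def using Comp_closed psi a b by blast+
  have lf: "l \<cdot> f = Id C X"
    unfolding l_def using Comp_assoc[OF f b psi] bf \<open>\<psi> \<cdot> \<phi> = Id C X\<close> by simp
  have fr: "f \<cdot> r = Id C Y"
    unfolding r_def using Comp_assoc[OF psi a f] fa \<open>\<phi> \<cdot> \<psi> = Id C Y\<close> by simp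
  have "l = (l \<cdot> f) \<cdot> r" using Comp_assoc[OF r f l] fr Id_right[OF l] by simp
  then have "l = r" using lf Id_left[OF r] by simp
  then show ?thesis
    unfolding iso_arr_def using Hom_dest[OF f] l lf fr by auto
qed

lemma is_coproduct_ex1:
  assumes "is_coproduct C I A S \<sigma>" "X \<in> Obj C" "\<And>k. k \<in> I \<Longrightarrow> g k \<in> Hom C (A k) X"
  shows "\<exists>!h. h \<in> Hom C S X \<and> (\<forall>k\<in>I. h \<cdot> \<sigma> k = g k)"
proof -
  have "\<forall>X \<in> Obj C. \<forall>g. (\<forall>k \<in> I. g k \<in> Hom C (A k) X) \<longrightarrow>
       (\<exists>!h. h \<in> Hom C S X \<and> (\<forall>k \<in> I. h \<cdot> \<sigma> k = g k))"
    using assms(1) unfolding is_coproduct_def by (elim conjE)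
  from this[THEN bspec, OF assms(2), THEN spec, of g, THEN mp] show ?thesis
    by (blast intro: assms(3))
qed

lemma is_product_ex1:
  assumes "is_product C I A P p" "X \<in> Obj C" "\<And>k. k \<in> I \<Longrightarrow> g k \<in> Hom C X (A k)"
  shows "\<exists>!h. h \<in> Hom C X P \<and> (\<forall>k\<in>I. p k \<cdot> h = g k)"
proof -
  have "\<forall>X \<in> Obj C. \<forall>g. (\<forall>k \<in> I. g k \<in> Hom C X (A k)) \<longrightarrow>
       (\<exists>!h. h \<in> Hom C X P \<and> (\<forall>k \<in> I. p k \<cdot> h = g k))"
    using assms(1) unfolding is_product_def by (elim conjE)
  from this[THEN bspec, OF assms(2), THEN spec, of g, THEN mp] show ?thesis
    by (blast intro: assms(3))
qed

lemma is_coproduct_unique: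
  assumes "is_coproduct C I A S \<sigma>" "h \<in> Hom C S X" "h' \<in> Hom C S X"
    and "\<And>k. k \<in> I \<Longrightarrow> h \<cdot> \<sigma> k = h' \<cdot> \<sigma> k"
  shows "h = h'"
proof -
  have "h \<cdot> \<sigma> k \<in> Hom C (A k) X" if "k \<in> I" for k
    using assms(1,2) that Comp_closed unfolding is_coproduct_def by blast
  then have "\<exists>!g. g \<in> Hom C S X \<and> (\<forall>k\<in>I. g \<cdot> \<sigma> k = h \<cdot> \<sigma> k)"
    by (rule is_coproduct_ex1[OF assms(1) Hom_dest(2)[OF assms(2)]])
  then show ?thesis using assms(2-4) by metis
qed

lemma is_product_unique:
  assumes "is_product C I A P p" "h \<in> Hom C X P" "h' \<in> Hom C X P"
    and "\<And>k. k \<in> I \<Longrightarrow> p k \<cdot> h = p k \<cdot> h'"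
  shows "h = h'"
proof -
  have "p k \<cdot> h \<in> Hom C X (A k)" if "k \<in> I" for k
    using assms(1,2) that Comp_closed unfolding is_product_def by blast
  then have "\<exists>!g. g \<in> Hom C X P \<and> (\<forall>k\<in>I. p k \<cdot> g = p k \<cdot> h)"
    by (rule is_product_ex1[OF assms(1) Hom_dest(1)[OF assms(2)]])
  then show ?thesis using assms(2-4) by metis
qed

text \<open>
  A matrix has a unique arrow: its columns are arrows into the product by the one universal
  property, and the columns assemble to an arrow out of the coproduct by the other.
\<close>
lemma matrix_arrow_ex1:
  assumes S: "is_coproduct C I A S \<sigma>" and P: "is_product C J B P p"
    and m: "\<And>k l. k \<in> I \<Longrightarrow> l \<in> J \<Longrightarrow> m k l \<in> Hom C (A k) (B l)"
  shows "\<exists>!h. h \<in> Hom C S P \<and> (\<forall>k\<in>I. \<forall>l\<in>J. p l \<cdot> h \<cdot> \<sigma> k = m k l)"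
proof -
  have \<sigma>: "\<sigma> k \<in> Hom C (A k) S" if "k \<in> I" for k
    using S that unfolding is_coproduct_def by blast
  have p: "p l \<in> Hom C P (B l)" if "l \<in> J" for l
    using P that unfolding is_product_def by blast
  have "\<exists>c. c \<in> Hom C (A k) P \<and> (\<forall>l\<in>J. p l \<cdot> c = m k l)" if k: "k \<in> I" for k
    using is_product_ex1[OF P Hom_dest(1)[OF \<sigma>[OF k]] m[OF k]] by blast
  then obtain c where c: "\<And>k. k \<in> I \<Longrightarrow> c k \<in> Hom C (A k) P"
      "\<And>k l. k \<in> I \<Longrightarrow> l \<in> J \<Longrightarrow> p l \<cdot> c k = m k l"
    by metis
  have "P \<in> Obj C" using P unfolding is_product_def by blast
  then obtain h where h: "h \<in> Hom C S P" "\<forall>k\<in>I. h \<cdot> \<sigma> k = c k"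
    using is_coproduct_ex1[OF S _ c(1)] by blast
  show ?thesis
  proof (rule ex1I[of _ h])
    show "h \<in> Hom C S P \<and> (\<forall>k\<in>I. \<forall>l\<in>J. p l \<cdot> h \<cdot> \<sigma> k = m k l)"
      using h c(2) by simp
  next
    fix h' assume h': "h' \<in> Hom C S P \<and> (\<forall>k\<in>I. \<forall>l\<in>J. p l \<cdot> h' \<cdot> \<sigma> k = m k l)"
    have "h' \<cdot> \<sigma> k = h \<cdot> \<sigma> k" if k: "k \<in> I" for k
    proof (rule is_product_unique[OF P])
      show "h' \<cdot> \<sigma> k \<in> Hom C (A k) P" "h \<cdot> \<sigma> k \<in> Hom C (A k) P"
        using Comp_closed[OF \<sigma>[OF k]] h(1) h' by blast+
      show "p l \<cdot> h' \<cdot> \<sigma> k = p l \<cdot> h \<cdot> \<sigma> k" if "l \<in> J" for l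
        using h' h(2) c(2) k that by simp
    qed
    then show "h' = h" using is_coproduct_unique[OF S] h(1) h' by blast
  qed
qed

end

section \<open>Zero arrows\<close>

locale category_with_zero = category C
  for C :: "('o, 'a, 'x) cat_scheme" (structure) +
  assumes ex_zero_object: "\<exists>Z. zero_object C Z"
begin

lemma zero_object_from:
  assumes "zero_object C Z" "X \<in> Obj C"
  obtains v where "v \<in> Hom C Z X"
  using assms unfolding zero_object_def initial_object_def by blast

lemma zero_object_to:
  assumes "zero_object C Z" "X \<in> Obj C"
  obtains u where "u \<in> Hom C X Z"
  using assms unfolding zero_object_def terminal_object_def by blast

lemma zero_object_from_unique:
  assumes "zero_object C Z" "v \<in> Hom C Z X" "v' \<in> Hom C Z X"
  shows "v = v'"
  using assms Hom_dest(2)[OF assms(2)] unfolding zero_object_def initial_object_def by blast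

lemma zero_object_to_unique:
  assumes "zero_object C Z" "u \<in> Hom C X Z" "u' \<in> Hom C X Z"
  shows "u = u'"
  using assms Hom_dest(1)[OF assms(2)] unfolding zero_object_def terminal_object_def by blast

lemma zero_arr_eq:
  assumes Z: "zero_object C Z" and u: "u \<in> Hom C X Z" and v: "v \<in> Hom C Z Y"
  shows "zero_arr C X Y = v \<cdot> u"
  unfolding zero_arr_def
proof (rule the_equality)
  show "\<exists>Z' u' v'. zero_object C Z' \<and> u' \<in> Hom C X Z' \<and> v' \<in> Hom C Z' Y \<and> v \<cdot> u = v' \<cdot> u'"
    using assms by blast
next
  fix h
  assume "\<exists>Z' u' v'. zero_object C Z' \<and> u' \<in> Hom C X Z' \<and> v' \<in> Hom C Z' Y \<and> h = v' \<cdot> u'"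
  then obtain Z' u' v' where Z': "zero_object C Z'" and u': "u' \<in> Hom C X Z'"
    and v': "v' \<in> Hom C Z' Y" and h: "h = v' \<cdot> u'" by blast
  \<comment> \<open>Both composites are \<open>X \<rightarrow> Z \<rightarrow> Z' \<rightarrow> Y\<close>.\<close>
  obtain t where t: "t \<in> Hom C Z Z'" using zero_object_from[OF Z Hom_dest(2)[OF u']] .
  have "t \<cdot> u = u'" using zero_object_to_unique[OF Z' Comp_closed[OF u t] u'] .
  moreover have "v' \<cdot> t = v" using zero_object_from_unique[OF Z Comp_closed[OF t v'] v] .
  ultimately show "h = v \<cdot> u" using h Comp_assoc[OF u t v'] by simp
qed

lemma zero_arr_factors:
  assumes "X \<in> Obj C" "Y \<in> Obj C"
  obtains Z u v where "zero_object C Z" "u \<in> Hom C X Z" "v \<in> Hom C Z Y"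
    "zero_arr C X Y = v \<cdot> u"
  using ex_zero_object assms zero_object_from zero_object_to zero_arr_eq by metis

lemma zero_arr_Hom: "X \<in> Obj C \<Longrightarrow> Y \<in> Obj C \<Longrightarrow> zero_arr C X Y \<in> Hom C X Y"
  by (metis zero_arr_factors Comp_closed)

lemma comp_zero_arr:
  assumes X: "X \<in> Obj C" and g: "g \<in> Hom C Y W"
  shows "g \<cdot> zero_arr C X Y = zero_arr C X W"
proof -
  obtain Z u v where Z: "zero_object C Z" and u: "u \<in> Hom C X Z" and v: "v \<in> Hom C Z Y"
    and eq: "zero_arr C X Y = v \<cdot> u"
    using zero_arr_factors[OF X Hom_dest(1)[OF g]] .
  show ?thesis
    using Comp_assoc[OF u v g] zero_arr_eq[OF Z u Comp_closed[OF v g]] eq by simp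
qed

lemma zero_arr_comp:
  assumes f: "f \<in> Hom C X Y" and W: "W \<in> Obj C"
  shows "zero_arr C Y W \<cdot> f = zero_arr C X W"
proof -
  obtain Z u v where Z: "zero_object C Z" and u: "u \<in> Hom C Y Z" and v: "v \<in> Hom C Z W"
    and eq: "zero_arr C Y W = v \<cdot> u"
    using zero_arr_factors[OF Hom_dest(2)[OF f] W] .
  show ?thesis
    using Comp_assoc[OF f u v] zero_arr_eq[OF Z Comp_closed[OF f u] v] eq by simp
qed

end

section \<open>The coproduct and product functors\<close>

locale category_with_sums_and_products = category_with_zero C
  for C :: "('o, 'a, 'x) cat_scheme" (structure) +
  fixes I :: "'i set"
    and S P :: "('i \<Rightarrow> 'o) \<Rightarrow> 'o"
    and \<sigma> p :: "('i \<Rightarrow> 'o) \<Rightarrow> 'i \<Rightarrow> 'a"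
  assumes coproducts: "coproduct_choice C I S \<sigma>"
    and products: "product_choice C I P p"
begin

abbreviation "Fam \<equiv> power_cat I C"
abbreviation "sum_map \<equiv> FArr (coproduct_ftor C I S \<sigma>)"
abbreviation "prod_map \<equiv> FArr (product_ftor C I P p)"
abbreviation "canon \<equiv> canonical_morphism C I S \<sigma> P p"

lemma is_coproduct_S: "A \<in> Obj Fam \<Longrightarrow> is_coproduct C I A (S A) (\<sigma> A)"
  using coproducts unfolding coproduct_choice_def by blast

lemma is_product_P: "A \<in> Obj Fam \<Longrightarrow> is_product C I A (P A) (p A)"
  using products unfolding product_choice_def by blast

lemma injection_Hom: "A \<in> Obj Fam \<Longrightarrow> k \<in> I \<Longrightarrow> \<sigma> A k \<in> Hom C (A k) (S A)"
  using is_coproduct_S unfolding is_coproduct_def by blast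

lemma projection_Hom: "A \<in> Obj Fam \<Longrightarrow> k \<in> I \<Longrightarrow> p A k \<in> Hom C (P A) (A k)"
  using is_product_P unfolding is_product_def by blast

lemma Obj_Fam_component: "A \<in> Obj Fam \<Longrightarrow> k \<in> I \<Longrightarrow> A k \<in> Obj C"
  unfolding power_cat_def by auto

lemma Hom_Fam_component: "f \<in> Hom Fam A B \<Longrightarrow> k \<in> I \<Longrightarrow> f k \<in> Hom C (A k) (B k)"
  unfolding power_cat_def Hom_def by (auto simp: PiE_def)

lemma Hom_Fam_dest:
  assumes "f \<in> Hom Fam A B"
  shows "A \<in> Obj Fam" "B \<in> Obj Fam" "Dom Fam f = A" "Cod Fam f = B"
  using assms Dom_closed Cod_closed unfolding power_cat_def Hom_def by (auto dest: PiE_mem)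

lemma family_in_Hom_Fam:
  assumes "A \<in> Obj Fam" "B \<in> Obj Fam" "\<And>k. k \<in> I \<Longrightarrow> g k \<in> Hom C (A k) (B k)"
  shows "restrict g I \<in> Hom Fam A B"
proof -
  have "(\<lambda>k\<in>I. Dom C (restrict g I k)) = A" "(\<lambda>k\<in>I. Cod C (restrict g I k)) = B"
    using assms unfolding power_cat_def Hom_def
    by (auto intro!: extensionalityI[of _ I] simp: PiE_def)
  then show ?thesis
    using assms(3) unfolding power_cat_def Hom_def by auto
qed

lemma sum_map:
  assumes f: "f \<in> Hom Fam A B"
  shows "sum_map f \<in> Hom C (S A) (S B)" (is ?in)
    and "k \<in> I \<Longrightarrow> sum_map f \<cdot> \<sigma> A k = \<sigma> B k \<cdot> f k"
proof -
  note d = Hom_Fam_dest[OF f]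
  have arrows: "\<sigma> B k \<cdot> f k \<in> Hom C (A k) (S B)" if "k \<in> I" for k
    using Comp_closed[OF Hom_Fam_component[OF f that] injection_Hom[OF d(2) that]] .
  have "S B \<in> Obj C" using is_coproduct_S[OF d(2)] unfolding is_coproduct_def by blast
  from theI'[OF is_coproduct_ex1[OF is_coproduct_S[OF d(1)] this arrows]]
  show ?in "k \<in> I \<Longrightarrow> sum_map f \<cdot> \<sigma> A k = \<sigma> B k \<cdot> f k"
    unfolding coproduct_ftor_def by (simp_all add: d)
qed

lemma prod_map:
  assumes f: "f \<in> Hom Fam A B"
  shows "prod_map f \<in> Hom C (P A) (P B)" (is ?in)
    and "k \<in> I \<Longrightarrow> p B k \<cdot> prod_map f = f k \<cdot> p A k"
proof -
  note d = Hom_Fam_dest[OF f]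
  have arrows: "f k \<cdot> p A k \<in> Hom C (P A) (B k)" if "k \<in> I" for k
    using Comp_closed[OF projection_Hom[OF d(1) that] Hom_Fam_component[OF f that]] .
  have "P A \<in> Obj C" using is_product_P[OF d(1)] unfolding is_product_def by blast
  from theI'[OF is_product_ex1[OF is_product_P[OF d(2)] this arrows]]
  show ?in "k \<in> I \<Longrightarrow> p B k \<cdot> prod_map f = f k \<cdot> p A k"
    unfolding product_ftor_def by (simp_all add: d)
qed

section \<open>Comparison with the canonical morphism\<close>

lemma canon:
  assumes A: "A \<in> Obj Fam"
  shows "canon A \<in> Hom C (S A) (P A)" (is ?in)
    and "k \<in> I \<Longrightarrow> l \<in> I \<Longrightarrow> p A l \<cdot> canon A \<cdot> \<sigma> A k =
      (if k = l then Id C (A k) else zero_arr C (A k) (A l))" (is "_ \<Longrightarrow> _ \<Longrightarrow> ?entry")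
proof -
  have "(if k = l then Id C (A k) else zero_arr C (A k) (A l)) \<in> Hom C (A k) (A l)"
    if "k \<in> I" "l \<in> I" for k l
    using that Id_closed zero_arr_Hom Obj_Fam_component[OF A] by simp
  from theI'[OF matrix_arrow_ex1[OF is_coproduct_S[OF A] is_product_P[OF A] this]]
  show ?in "k \<in> I \<Longrightarrow> l \<in> I \<Longrightarrow> ?entry"
    unfolding canonical_morphism_def by auto
qed

text \<open>
  The rule for matrix products: if \<open>q\<close> is a projection, \<open>\<Oplus>f\<close> multiplies the entries of \<open>h\<close>
  in column \<open>k\<close> by \<open>f k\<close>. Dually, \<open>\<Prod>f\<close> below multiplies row \<open>l\<close> by \<open>f l\<close>.
\<close>
lemma matrix_sum_map:
  assumes f: "f \<in> Hom Fam A B" and h: "h \<in> Hom C (S B) X" and q: "q \<in> Hom C X Y"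
    and k: "k \<in> I"
  shows "q \<cdot> (h \<cdot> sum_map f) \<cdot> \<sigma> A k = (q \<cdot> h \<cdot> \<sigma> B k) \<cdot> f k"
proof -
  note d = Hom_Fam_dest[OF f]
  note fk = Hom_Fam_component[OF f k] and \<sigma> = injection_Hom[OF d(2) k]
  have "(h \<cdot> sum_map f) \<cdot> \<sigma> A k = (h \<cdot> \<sigma> B k) \<cdot> f k"
    using Comp_assoc[OF injection_Hom[OF d(1) k] sum_map(1)[OF f] h]
      Comp_assoc[OF fk \<sigma> h] sum_map(2)[OF f k] by simp
  then show ?thesis using Comp_assoc[OF fk Comp_closed[OF \<sigma> h] q] by simp
qed

lemma matrix_prod_map:
  assumes f: "f \<in> Hom Fam A B" and h: "h \<in> Hom C X (P A)" and s: "s \<in> Hom C W X"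
    and l: "l \<in> I"
  shows "p B l \<cdot> (prod_map f \<cdot> h) \<cdot> s = f l \<cdot> (p A l \<cdot> h \<cdot> s)"
proof -
  note d = Hom_Fam_dest[OF f]
  note hs = Comp_closed[OF s h]
  have "p B l \<cdot> (prod_map f \<cdot> h) \<cdot> s = (p B l \<cdot> prod_map f) \<cdot> h \<cdot> s"
    using Comp_assoc[OF s h prod_map(1)[OF f]]
      Comp_assoc[OF hs prod_map(1)[OF f] projection_Hom[OF d(2) l]] by simp
  then show ?thesis
    using prod_map(2)[OF f l]
      Comp_assoc[OF hs projection_Hom[OF d(1) l] Hom_Fam_component[OF f l]] by simp
qed

text \<open>
  The identity matrix times a diagonal matrix, in either order, is that diagonal matrix. Applied
  to \<open>h = \<Prod>f \<circ> F\<^sub>A\<close> this gives the naturality of the canonical morphism; applied to a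
  component \<open>h\<close> of a natural isomorphism, which turns out to be diagonal, it exhibits the
  canonical morphism as a factor of \<open>h\<close> on either side.
\<close>
lemma diagonal_arrow_factors:
  assumes f: "f \<in> Hom Fam A B" and h: "h \<in> Hom C (S A) (P B)"
    and entry: "\<And>k l. k \<in> I \<Longrightarrow> l \<in> I \<Longrightarrow>
      p B l \<cdot> h \<cdot> \<sigma> A k = (if k = l then f k else zero_arr C (A k) (B l))"
  shows "canon B \<cdot> sum_map f = h" "prod_map f \<cdot> canon A = h"
proof -
  note d = Hom_Fam_dest[OF f]
  note A = Obj_Fam_component[OF d(1)] and B = Obj_Fam_component[OF d(2)]
  note fk = Hom_Fam_component[OF f]
  define m where "m k l = (if k = l then f k else zero_arr C (A k) (B l))" for k l
  have "m k l \<in> Hom C (A k) (B l)" if "k \<in> I" "l \<in> I" for k l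
    using that fk A B zero_arr_Hom unfolding m_def by simp
  then have uniq: "\<exists>!h. h \<in> Hom C (S A) (P B) \<and>
      (\<forall>k\<in>I. \<forall>l\<in>I. p B l \<cdot> h \<cdot> \<sigma> A k = m k l)"
    by (intro matrix_arrow_ex1[OF is_coproduct_S[OF d(1)] is_product_P[OF d(2)]])
  have "p B l \<cdot> (canon B \<cdot> sum_map f) \<cdot> \<sigma> A k = m k l" if k: "k \<in> I" and l: "l \<in> I" for k l
    using matrix_sum_map[OF f canon(1)[OF d(2)] projection_Hom[OF d(2) l] k]
      canon(2)[OF d(2) k l] Id_left[OF fk[OF k]] zero_arr_comp[OF fk[OF k] B[OF l]]
    by (cases "k = l") (simp_all add: m_def)
  then show "canon B \<cdot> sum_map f = h"
    using uniq h entry Comp_closed[OF sum_map(1)[OF f] canon(1)[OF d(2)]]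
    unfolding m_def by blast
  have "p B l \<cdot> (prod_map f \<cdot> canon A) \<cdot> \<sigma> A k = m k l" if k: "k \<in> I" and l: "l \<in> I" for k l
    using matrix_prod_map[OF f canon(1)[OF d(1)] injection_Hom[OF d(1) k] l]
      canon(2)[OF d(1) k l] Id_right[OF fk[OF l]] comp_zero_arr[OF A[OF k] fk[OF l]]
    by (cases "k = l") (simp_all add: m_def)
  then show "prod_map f \<cdot> canon A = h"
    using uniq h entry Comp_closed[OF canon(1)[OF d(1)] prod_map(1)[OF f]]
    unfolding m_def by blast
qed

lemma canon_natural:
  assumes f: "f \<in> Hom Fam A B"
  shows "canon B \<cdot> sum_map f = prod_map f \<cdot> canon A"
proof (rule diagonal_arrow_factors(1)[OF f])
  note d = Hom_Fam_dest[OF f]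
  show "prod_map f \<cdot> canon A \<in> Hom C (S A) (P B)"
    using Comp_closed[OF canon(1)[OF d(1)] prod_map(1)[OF f]] .
  show "p B l \<cdot> (prod_map f \<cdot> canon A) \<cdot> \<sigma> A k =
      (if k = l then f k else zero_arr C (A k) (B l))" if k: "k \<in> I" and l: "l \<in> I" for k l
    using matrix_prod_map[OF f canon(1)[OF d(1)] injection_Hom[OF d(1) k] l]
      canon(2)[OF d(1) k l] Id_right[OF Hom_Fam_component[OF f l]]
      comp_zero_arr[OF Obj_Fam_component[OF d(1) k] Hom_Fam_component[OF f l]]
    by (cases "k = l") simp_all
qed

text \<open>
  The endomorphism \<open>e\<close> of \<open>A\<close> that is the identity at \<open>k\<close> and zero elsewhere fixes the entry
  \<open>A k \<rightarrow> A l\<close> when it acts on the coproduct side and kills it when it acts on the product side;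
  naturality says that the two results are the same.
\<close>
lemma natural_entries_off_diagonal:
  assumes nat: "natural_transformation Fam C (coproduct_ftor C I S \<sigma>) (product_ftor C I P p) \<phi>"
    and A: "A \<in> Obj Fam" and k: "k \<in> I" and l: "l \<in> I" and "k \<noteq> l"
  shows "p A l \<cdot> \<phi> A \<cdot> \<sigma> A k = zero_arr C (A k) (A l)"
proof -
  define e where "e = (\<lambda>i\<in>I. if i = k then Id C (A i) else zero_arr C (A i) (A i))"
  have e: "e \<in> Hom Fam A A"
    unfolding e_def using Obj_Fam_component[OF A] Id_closed zero_arr_Hom
    by (intro family_in_Hom_Fam[OF A A]) auto
  have ek: "e k = Id C (A k)" and el: "e l = zero_arr C (A l) (A l)"
    using k l \<open>k \<noteq> l\<close> by (simp_all add: e_def)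
  have phi: "\<phi> A \<in> Hom C (S A) (P A)"
    using nat A unfolding natural_transformation_def coproduct_ftor_def product_ftor_def by simp
  have comm: "\<phi> A \<cdot> sum_map e = prod_map e \<cdot> \<phi> A"
    using nat e unfolding natural_transformation_def by blast
  note \<sigma> = injection_Hom[OF A k] and p = projection_Hom[OF A l]
  have entry: "p A l \<cdot> \<phi> A \<cdot> \<sigma> A k \<in> Hom C (A k) (A l)"
    using Comp_closed[OF Comp_closed[OF \<sigma> phi] p] .
  have "p A l \<cdot> \<phi> A \<cdot> \<sigma> A k = p A l \<cdot> (\<phi> A \<cdot> sum_map e) \<cdot> \<sigma> A k"
    using matrix_sum_map[OF e phi p k] ek Id_right[OF entry] by simp
  also have "\<dots> = zero_arr C (A l) (A l) \<cdot> (p A l \<cdot> \<phi> A \<cdot> \<sigma> A k)"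
    using matrix_prod_map[OF e phi \<sigma> l] el comm by simp
  also have "\<dots> = zero_arr C (A k) (A l)"
    using zero_arr_comp[OF entry Obj_Fam_component[OF A l]] .
  finally show ?thesis .
qed

lemma canon_iso:
  assumes iso: "natural_isomorphism Fam C (coproduct_ftor C I S \<sigma>) (product_ftor C I P p) \<phi>"
    and A: "A \<in> Obj Fam"
  shows "iso_arr C (canon A)"
proof -
  have nat: "natural_transformation Fam C (coproduct_ftor C I S \<sigma>) (product_ftor C I P p) \<phi>"
    and phi_iso: "iso_arr C (\<phi> A)"
    using iso A unfolding natural_isomorphism_def by blast+
  have phi: "\<phi> A \<in> Hom C (S A) (P A)"
    using nat A unfolding natural_transformation_def coproduct_ftor_def product_ftor_def by simp
  define \<theta> where "\<theta> = (\<lambda>k\<in>I. p A k \<cdot> \<phi> A \<cdot> \<sigma> A k)"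
  have \<theta>: "\<theta> \<in> Hom Fam A A"
    unfolding \<theta>_def
    using Comp_closed[OF Comp_closed[OF injection_Hom[OF A] phi] projection_Hom[OF A]]
    by (intro family_in_Hom_Fam[OF A A])
  have "p A l \<cdot> \<phi> A \<cdot> \<sigma> A k = (if k = l then \<theta> k else zero_arr C (A k) (A l))"
    if "k \<in> I" "l \<in> I" for k l
    using that natural_entries_off_diagonal[OF nat A] by (simp add: \<theta>_def)
  from diagonal_arrow_factors[OF \<theta> phi this]
  show ?thesis
    using iso_arr_two_sided_factor[OF canon(1)[OF A] sum_map(1)[OF \<theta>] prod_map(1)[OF \<theta>]]
      phi_iso by blast
qed

end

theorem proposition1p2:
  fixes C :: "('o, 'a) cat"
    and H :: "'o \<Rightarrow> 'o \<Rightarrow> 'a monoid"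
    and I :: "'i set"
    and S P :: "('i \<Rightarrow> 'o) \<Rightarrow> 'o"
    and \<sigma> p :: "('i \<Rightarrow> 'o) \<Rightarrow> 'i \<Rightarrow> 'a"
  assumes "amon_category C H"
    and "\<exists>Z. zero_object C Z"
    and "coproduct_choice C I S \<sigma>"
    and "product_choice C I P p"
    and "\<exists>\<phi>. natural_isomorphism (power_cat I C) C
           (coproduct_ftor C I S \<sigma>) (product_ftor C I P p) \<phi>"
  shows "natural_isomorphism (power_cat I C) C
           (coproduct_ftor C I S \<sigma>) (product_ftor C I P p)
           (canonical_morphism C I S \<sigma> P p)"
proof -
  interpret amon_category C H by fact
  interpret category_with_sums_and_products C I S P \<sigma> p
    using assms(2-4) by unfold_locales
  obtain \<phi> where iso: "natural_isomorphism (power_cat I C) C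
      (coproduct_ftor C I S \<sigma>) (product_ftor C I P p) \<phi>"
    using assms(5) by blast
  then have "is_ftor (power_cat I C) C (coproduct_ftor C I S \<sigma>)"
    and "is_ftor (power_cat I C) C (product_ftor C I P p)"
    unfolding natural_isomorphism_def natural_transformation_def by blast+
  moreover have "canon A \<in> Hom C (FObj (coproduct_ftor C I S \<sigma>) A) (FObj (product_ftor C I P p) A)"
    if "A \<in> Obj Fam" for A
    using canon(1)[OF that] by (simp add: coproduct_ftor_def product_ftor_def)
  ultimately show ?thesis
    using canon_natural canon_iso[OF iso]
    unfolding natural_isomorphism_def natural_transformation_def by blast
qed

end
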